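(* Let $X \in \mathbb{R}^{N\times D}$ and $W_h^Q, W_h^K, W_h^V\in\mathbb{R}^{D\times d}$, let $A_h = \frac{1}{\sqrt{d}}W_h^Q (W_h^K)^\top \in\mathbb{R}^{D\times D}$, let $P^h = \mathrm{sm}(XA_hX^\top)\in\mathbb{R}^{N\times N}$, and let $\mathrm{Attn}_h(X) = \mathrm{sm}(XA_hX^\top)XW_h^V$ be the dot-product self-attention map $\mathbb{R}^{N\times D}\to\mathbb{R}^{N\times d}$. Then its Jacobian at $X$ satisfies $$\|\mathcal{J}_{\mathrm{Attn}_h}(X)\|_2 \leqslant \|W_h^V\|_2\cdot\Big(\|P^h\|_2 + 2\,\|X\|_2^2\,\|A_h\|_2\,\max_{i=1,\dots,N}\|\mathcal{M}(P^h_{i,:})\|_2\Big).$$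
   Context: $\mathrm{sm}$ denotes the row-wise softmax: for a vector $z\in\mathbb{R}^N$, $\mathrm{sm}(z)_i = e^{z_i}/\sum_{j=1}^N e^{z_j}$, and for a matrix it is applied to each row separately. $P^h_{i,:}$ denotes the $i$-th row of $P^h$. For a vector $x\in\mathbb{R}^N$ (regarded as a column vector), $\mathcal{M}(x) = \mathrm{diag}(x) - xx^\top\in\mathbb{R}^{N\times N}$; so $\mathcal{M}(P^h_{i,:}) = \mathrm{diag}(P^h_{i,:}) - (P^h_{i,:})^\top P^h_{i,:}$. $\mathcal{J}_{\mathrm{Attn}_h}(X)\in\mathbb{R}^{Nd\times ND}$ is the Jacobian matrix of $\mathrm{Attn}_h$ with respect to $X$ (the weights being fixed), where matrices are vectorized in row-major order: $\mathrm{vec}(d\,\mathrm{Attn}_h(X)) = \mathcal{J}_{\mathrm{Attn}_h}(X)\,\mathrm{vec}(dX)$. $\|\cdot\|_2$ of a matrix is the spectral norm (largest singular value). *)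

theory Defs
  imports "HOL-Analysis.Analysis"
begin

text \<open>
  Singular values as square roots of the eigenvalues of \<open>A\<^sup>T A\<close>. A wide matrix may
  acquire additional zeros this way, which does not affect the largest singular value.
\<close>

definition singular_values :: "real^'c^'r \<Rightarrow> real set" where
  "singular_values A =
     {sqrt l | l. \<exists>v. v \<noteq> 0 \<and> (transpose A ** A) *v v = l *\<^sub>R v}"

definition spectral_norm :: "real^'c^'r \<Rightarrow> real" where
  "spectral_norm A = Max (singular_values A)"

lemma transpose_mult_inner:
  fixes A :: "real^'c^'r"
  shows "((transpose A ** A) *v u) \<bullet> w = (A *v u) \<bullet> (A *v w)"
  by (simp add: transpose_matrix_vector dot_lmul_matrix flip: matrix_vector_mul_assoc)

text \<open>\<^term>\<open>Max\<close> is only meaningful on a finite nonempty set.\<close>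

lemma finite_singular_values: "finite (singular_values (A :: real^'c^'r))"
proof -
  let ?S = "transpose A ** A"
  let ?E = "{l. \<exists>v. v \<noteq> 0 \<and> ?S *v v = l *\<^sub>R v}"
  have "\<forall>l\<in>?E. \<exists>v. v \<noteq> 0 \<and> ?S *v v = l *\<^sub>R v" by blast
  from bchoice[OF this] obtain e
    where e: "\<And>l. l \<in> ?E \<Longrightarrow> e l \<noteq> 0 \<and> ?S *v e l = l *\<^sub>R e l"
    by blast
  have orth: "e k \<bullet> e l = 0" if "k \<in> ?E" "l \<in> ?E" "k \<noteq> l" for k l
  proof -
    have "k * (e k \<bullet> e l) = (?S *v e k) \<bullet> e l" using e[OF that(1)] by simp
    also have "\<dots> = (?S *v e l) \<bullet> e k" unfolding transpose_mult_inner by (rule inner_commute)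
    also have "\<dots> = l * (e k \<bullet> e l)" using e[OF that(2)] by (simp add: inner_commute)
    finally show ?thesis using that(3) by simp
  qed
  have inj: "inj_on e ?E"
  proof (rule inj_onI, rule ccontr)
    fix k l assume h: "k \<in> ?E" "l \<in> ?E" "e k = e l" "k \<noteq> l"
    then show False using orth[of k l] e[of l] by simp
  qed
  have "pairwise orthogonal (e ` ?E)"
    by (auto simp: pairwise_def orthogonal_def intro!: orth)
  moreover have "0 \<notin> e ` ?E" using e by force
  ultimately have "finite (e ` ?E)"
    using pairwise_orthogonal_independent independent_imp_finite by blast
  then have "finite ?E" using inj finite_image_iff by blast
  moreover have "singular_values A = sqrt ` ?E" by (auto simp: singular_values_def)
  ultimately show ?thesis by simp
qed

lemma singular_values_le_onorm:
  fixes A :: "real^'c^'r"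
  assumes "s \<in> singular_values A"
  shows "s \<le> onorm ((*v) A)"
proof -
  obtain l v where l: "s = sqrt l" "v \<noteq> 0" "(transpose A ** A) *v v = l *\<^sub>R v"
    using assms by (auto simp: singular_values_def)
  have "(norm (A *v v))\<^sup>2 = l * (norm v)\<^sup>2"
    using transpose_mult_inner[of A v v] l(3) by (simp add: power2_norm_eq_inner)
  then have "norm (A *v v) = s * norm v"
    using l(1) by (metis abs_norm_cancel real_sqrt_abs real_sqrt_mult)
  then have "s * norm v \<le> onorm ((*v) A) * norm v"
    using onorm[OF matrix_vector_mul_bounded_linear, of A v] by simp
  then show ?thesis using l(2) by simp
qed

lemma onorm_in_singular_values:
  fixes A :: "real^'c^'r"
  shows "onorm ((*v) A) \<in> singular_values A"
proof -
  let ?S = "transpose A ** A"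
  have "continuous_on (sphere (0::real^'c) 1) (\<lambda>x. norm (A *v x))"
    by (intro continuous_intros)
  moreover have "axis undefined 1 \<in> sphere (0::real^'c) 1" by simp
  ultimately obtain x where x: "norm x = 1"
      and mx: "\<And>y. norm y = 1 \<Longrightarrow> norm (A *v y) \<le> norm (A *v x)"
    using continuous_attains_sup[OF compact_sphere, of "0::real^'c" 1 "\<lambda>x. norm (A *v x)"]
    by (metis empty_iff mem_sphere_0)
  define m where "m = norm (A *v x)"
  have bd: "norm (A *v y) \<le> m * norm y" for y
  proof (cases "y = 0")
    case False
    have "norm (A *v ((1 / norm y) *\<^sub>R y)) \<le> m"
      unfolding m_def using False by (intro mx) simp
    then show ?thesis using False by (simp add: matrix_vector_mult_scaleR field_simps)
  qed simp
  have "onorm ((*v) A) = m"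
  proof (rule antisym)
    show "onorm ((*v) A) \<le> m" using bd by (rule onorm_le)
    show "m \<le> onorm ((*v) A)"
      using onorm[OF matrix_vector_mul_bounded_linear, of A x] x by (simp add: m_def)
  qed
  moreover have "?S *v x = m\<^sup>2 *\<^sub>R x"
  proof -
    define T where "T y = m\<^sup>2 *\<^sub>R y - ?S *v y" for y
    have Tlin: "T (a + t *\<^sub>R b) = T a + t *\<^sub>R T b" for a b t
      by (simp add: T_def matrix_vector_right_distrib matrix_vector_mult_scaleR algebra_simps)
    have Tinner: "T a \<bullet> b = m\<^sup>2 * (a \<bullet> b) - (A *v a) \<bullet> (A *v b)" for a b
      by (simp add: T_def inner_diff_left transpose_mult_inner)
    have Tsym: "T a \<bullet> b = T b \<bullet> a" for a b
      by (simp add: Tinner inner_commute[of a b] inner_commute[of "A *v a" "A *v b"])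
    have Tpos: "T y \<bullet> y \<ge> 0" for y
    proof -
      have "(norm (A *v y))\<^sup>2 \<le> (m * norm y)\<^sup>2" using bd by (intro power_mono) auto
      then show ?thesis
        by (simp add: Tinner power_mult_distrib flip: power2_norm_eq_inner)
    qed
    have T0: "T x \<bullet> x = 0"
      using x by (simp add: Tinner m_def flip: power2_norm_eq_inner)
    define w a b where "w = T x" and "a = w \<bullet> w" and "b = T w \<bullet> w"
    have q: "0 \<le> 2 * t * a + t\<^sup>2 * b" for t
    proof -
      have "T (x + t *\<^sub>R w) \<bullet> (x + t *\<^sub>R w) = 2 * t * a + t\<^sup>2 * b"
        using T0 Tsym[of w x]
        by (simp add: Tlin inner_add_left inner_add_right a_def b_def w_def power2_eq_square
            algebra_simps)
      then show ?thesis using Tpos by metis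
    qed
    have "a = 0"
    proof (rule ccontr)
      assume "a \<noteq> 0"
      then have a: "a > 0" by (simp add: a_def)
      have b: "b \<ge> 0" by (simp add: b_def Tpos)
      have "0 \<le> 2 * (- a / (b + 1)) * a + (- a / (b + 1))\<^sup>2 * b" by (rule q)
      also have "\<dots> = (a / (b + 1))\<^sup>2 * (- b - 2)"
        using b by (simp add: power2_eq_square divide_simps) (simp add: algebra_simps)
      also have "\<dots> < 0" using a b by (intro mult_pos_neg) auto
      finally show False by simp
    qed
    then show ?thesis by (simp add: a_def w_def T_def)
  qed
  moreover have "m = sqrt (m\<^sup>2)" by (simp add: m_def)
  moreover have "x \<noteq> 0" using x by auto
  ultimately show ?thesis unfolding singular_values_def by blast
qed

lemma spectral_norm_eq_onorm: "spectral_norm A = onorm ((*v) A)"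
  unfolding spectral_norm_def
  by (intro Max_eqI finite_singular_values singular_values_le_onorm onorm_in_singular_values)

text \<open>
  Row-major vectorization: the entries are indexed by pairs (row, column), whose
  lexicographic order is the row-major order.
\<close>

definition vec_row_major :: "real^'c^'r \<Rightarrow> real^('r \<times> 'c)" where
  "vec_row_major M = (\<chi> p. M $ fst p $ snd p)"

definition unvec_row_major :: "real^('r \<times> 'c) \<Rightarrow> real^'c^'r" where
  "unvec_row_major v = (\<chi> i j. v $ (i, j))"

definition matrix_jacobian ::
    "(real^'c^'r \<Rightarrow> real^'k^'m) \<Rightarrow> real^'c^'r \<Rightarrow> real^('r \<times> 'c)^('m \<times> 'k)" where
  "matrix_jacobian f X =
     jacobian (\<lambda>v. vec_row_major (f (unvec_row_major v))) (at (vec_row_major X))"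

lemma unvec_vec_row_major [simp]: "unvec_row_major (vec_row_major M) = M"
  by (simp add: unvec_row_major_def vec_row_major_def vec_eq_iff)

lemma vec_unvec_row_major [simp]: "vec_row_major (unvec_row_major v) = v"
  by (simp add: unvec_row_major_def vec_row_major_def vec_eq_iff)

lemma bounded_linear_vec_row_major: "bounded_linear vec_row_major"
  by (intro linear_conv_bounded_linear[THEN iffD1] linearI)
    (simp_all add: vec_row_major_def vec_eq_iff)

lemma bounded_linear_unvec_row_major: "bounded_linear unvec_row_major"
  by (intro linear_conv_bounded_linear[THEN iffD1] linearI)
    (simp_all add: unvec_row_major_def vec_eq_iff)

lemma matrix_jacobian_works:
  assumes "(f has_derivative f') (at X)"
  shows "vec_row_major (f' H) = matrix_jacobian f X *v vec_row_major H"
proof -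
  let ?g = "\<lambda>v. vec_row_major (f (unvec_row_major v))"
  have "((\<lambda>v. f (unvec_row_major v)) has_derivative (\<lambda>v. f' (unvec_row_major v)))
          (at (vec_row_major X))"
    using assms
    by (intro has_derivative_compose[where g = f and f = unvec_row_major]
        bounded_linear_imp_has_derivative bounded_linear_unvec_row_major) simp
  then have d: "(?g has_derivative (\<lambda>v. vec_row_major (f' (unvec_row_major v))))
          (at (vec_row_major X))"
    by (rule bounded_linear.has_derivative[OF bounded_linear_vec_row_major])
  then have "(?g has_derivative (\<lambda>h. matrix_jacobian f X *v h)) (at (vec_row_major X))"
    unfolding matrix_jacobian_def using jacobian_works differentiableI by blast
  from fun_cong[OF has_derivative_unique[OF d this], of "vec_row_major H"]
  show ?thesis by simp
qed

definition softmax :: "real^'n \<Rightarrow> real^'n" where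
  "softmax z = (\<chi> i. exp (z $ i) / (\<Sum>j\<in>UNIV. exp (z $ j)))"

definition softmax_rows :: "real^'c^'r \<Rightarrow> real^'c^'r" where
  "softmax_rows Z = (\<chi> i. softmax (row i Z))"

definition diag_matrix :: "real^'n \<Rightarrow> real^'n^'n" where
  "diag_matrix x = (\<chi> i j. if i = j then x $ i else 0)"

definition softmax_cov :: "real^'n \<Rightarrow> real^'n^'n" where
  "softmax_cov x = diag_matrix x - (columnvector x :: real^1^'n) ** rowvector x"

definition attn :: "real^'D^'D \<Rightarrow> real^'d^'D \<Rightarrow> real^'D^'N \<Rightarrow> real^'d^'N" where
  "attn A WV X = softmax_rows (X ** A ** transpose X) ** X ** WV"

end

theory Submission
  imports Defs
begin

text \<open>
  The norm on \<^typ>\<open>real^'c^'r\<close> is the Frobenius norm, which row-major vectorization preserves.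
  Hence the spectral norm of the Jacobian is the operator norm of the derivative of attention
  with respect to Frobenius norms. That derivative is
  \<open>H \<mapsto> dP ** X ** W + P ** H ** W\<close>, where the \<open>i\<close>-th row of \<open>dP\<close> is the softmax covariance
  at \<open>P\<^sub>i\<close> applied to the \<open>i\<close>-th row of \<open>H ** A ** X\<^sup>T + X ** A ** H\<^sup>T\<close>. The bound follows from
  the Frobenius norm being submultiplicative with respect to the spectral norm on either side.
\<close>

lemma norm_matrix_vector_mult_le: "norm (M *v v) \<le> spectral_norm M * norm v"
  unfolding spectral_norm_eq_onorm by (rule onorm[OF matrix_vector_mul_bounded_linear])

lemma spectral_norm_nonneg: "0 \<le> spectral_norm M"
  unfolding spectral_norm_eq_onorm by (rule onorm_pos_le[OF matrix_vector_mul_bounded_linear])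

lemma spectral_norm_le:
  assumes "\<And>v. norm (M *v v) \<le> c * norm v"
  shows "spectral_norm M \<le> c"
  unfolding spectral_norm_eq_onorm using assms by (rule onorm_le)

text \<open>The square of \<open>norm (transpose M *v v)\<close> is
  \<open>v \<bullet> (M *v (transpose M *v v))\<close>; Cauchy-Schwarz then leaves a common factor
  \<open>norm (transpose M *v v)\<close> to cancel. One inequality suffices, since transposition is
  an involution.\<close>

lemma spectral_norm_transpose_le: "spectral_norm (transpose M) \<le> spectral_norm M"
proof (rule spectral_norm_le)
  fix v
  have "(norm (transpose M *v v))\<^sup>2 = v \<bullet> (M *v (transpose M *v v))"
    by (simp add: power2_norm_eq_inner transpose_matrix_vector dot_lmul_matrix)
  also have "\<dots> \<le> norm v * norm (M *v (transpose M *v v))"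
    by (rule norm_cauchy_schwarz)
  also have "\<dots> \<le> norm v * (spectral_norm M * norm (transpose M *v v))"
    by (intro mult_left_mono norm_matrix_vector_mult_le norm_ge_zero)
  finally have "norm (transpose M *v v) * norm (transpose M *v v)
      \<le> (spectral_norm M * norm v) * norm (transpose M *v v)"
    by (simp add: power2_eq_square mult_ac)
  then show "norm (transpose M *v v) \<le> spectral_norm M * norm v"
    using spectral_norm_nonneg[of M]
    by (cases "norm (transpose M *v v) = 0") (auto simp: mult_le_cancel_right)
qed

lemma spectral_norm_transpose: "spectral_norm (transpose M) = spectral_norm M"
  using spectral_norm_transpose_le[of M] spectral_norm_transpose_le[of "transpose M"] by simp

lemma power2_norm_matrix: "(norm (M :: real^'c^'r))\<^sup>2 = (\<Sum>i\<in>UNIV. \<Sum>j\<in>UNIV. (M $ i $ j)\<^sup>2)"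
  unfolding power2_norm_eq_inner by (simp add: inner_vec_def power2_eq_square)

lemma norm_vec_row_major: "norm (vec_row_major M) = norm M"
proof -
  have "(norm (vec_row_major M))\<^sup>2 = (norm M)\<^sup>2"
    unfolding power2_norm_eq_inner
    by (simp add: inner_vec_def vec_row_major_def sum.cartesian_product case_prod_beta)
  then show ?thesis by simp
qed

lemma norm_transpose: "norm (transpose (M :: real^'c^'r)) = norm M"
proof -
  have "(norm (transpose M))\<^sup>2 = (norm M)\<^sup>2"
    unfolding power2_norm_matrix transpose_def by (subst sum.swap) simp
  then show ?thesis by simp
qed

text \<open>The Frobenius norm is the l2 norm of the row norms. This serves both right
  multiplication by a fixed matrix and the softmax derivative, which applies a different matrix to
  each row.\<close>

lemma norm_le_rows:
  fixes M :: "real^'c^'r" and L :: "real^'k^'r"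
  assumes "\<And>i. norm (M $ i) \<le> c * norm (L $ i)" and "0 \<le> c"
  shows "norm M \<le> c * norm L"
proof -
  have "norm M = L2_set (\<lambda>i. norm (M $ i)) UNIV" by (rule norm_vec_def)
  also have "\<dots> \<le> L2_set (\<lambda>i. c * norm (L $ i)) UNIV"
    by (intro L2_set_mono assms norm_ge_zero)
  also have "\<dots> = c * norm L"
    using assms(2) by (simp add: L2_set_right_distrib norm_vec_def)
  finally show ?thesis .
qed

text \<open>Right multiplication acts on each row separately, as \<open>transpose B\<close> applied
  to that row taken as a column vector.\<close>

lemma norm_matrix_mult_le_right: "norm (M ** B) \<le> norm M * spectral_norm B"
proof -
  have "norm (M ** B) \<le> spectral_norm (transpose B) * norm M"
  proof (rule norm_le_rows)
    fix i
    have "(M ** B) $ i = transpose B *v (M $ i)"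
      by (simp add: vec_eq_iff matrix_matrix_mult_def matrix_vector_mult_def transpose_def mult.commute)
    then show "norm ((M ** B) $ i) \<le> spectral_norm (transpose B) * norm (M $ i)"
      using norm_matrix_vector_mult_le[of "transpose B" "M $ i"] by presburger
  qed (rule spectral_norm_nonneg)
  then show ?thesis by (simp add: spectral_norm_transpose mult.commute)
qed

lemma norm_matrix_mult_le_left: "norm (B ** M) \<le> spectral_norm B * norm M"
  using norm_matrix_mult_le_right[of "transpose M" "transpose B"]
  by (simp add: norm_transpose spectral_norm_transpose mult.commute flip: matrix_transpose_mul)

lemma bounded_bilinear_matrix_matrix_mult:
  "bounded_bilinear ((**) :: real^'k^'r \<Rightarrow> real^'c^'k \<Rightarrow> real^'c^'r)"
  unfolding bilinear_conv_bounded_bilinear[symmetric] bilinear_def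
  by (auto intro!: linearI simp: vec_eq_iff matrix_matrix_mult_def sum.distrib algebra_simps
      sum_distrib_left)

lemma bounded_linear_transpose: "bounded_linear (transpose :: real^'c^'r \<Rightarrow> real^'r^'c)"
  by (intro linear_conv_bounded_linear[THEN iffD1] linearI)
    (simp_all add: transpose_def vec_eq_iff)

text \<open>For the converse, basis vectors have the form \<open>axis i b\<close>, so each scalar
  coordinate is an inner product with a single component \<open>f x $ i\<close>.\<close>

lemma has_derivative_vec_nth_iff:
  fixes f :: "'a::real_normed_vector \<Rightarrow> 'b::euclidean_space^'n"
  shows "(f has_derivative f') (at x) \<longleftrightarrow>
    (\<forall>i. ((\<lambda>x. f x $ i) has_derivative (\<lambda>h. f' h $ i)) (at x))"
proof
  assume "(f has_derivative f') (at x)"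
  then show "\<forall>i. ((\<lambda>x. f x $ i) has_derivative (\<lambda>h. f' h $ i)) (at x)"
    by (auto intro: bounded_linear.has_derivative[OF bounded_linear_vec_nth])
next
  assume "\<forall>i. ((\<lambda>x. f x $ i) has_derivative (\<lambda>h. f' h $ i)) (at x)"
  then show "(f has_derivative f') (at x)"
    by (subst has_derivative_componentwise_within)
      (auto simp: Basis_vec_def inner_axis intro!: has_derivative_inner_left)
qed

text \<open>In this form, the deviation of \<open>h $ i\<close> from the \<open>x\<close>-weighted
  sum of \<open>h\<close>, the matrix can be compared with the quotient rule for softmax.\<close>

lemma softmax_cov_mult_nth:
  "(softmax_cov x *v h) $ i = x $ i * (h $ i - (\<Sum>j\<in>UNIV. x $ j * h $ j))"
  by (simp add: softmax_cov_def diag_matrix_def matrix_vector_mult_def matrix_matrix_mult_def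
      columnvector_def rowvector_def left_diff_distrib right_diff_distrib sum_subtractf
      sum_distrib_left mult_ac if_distrib[where f = "\<lambda>t. _ * t"] cong: if_cong)

lemma has_derivative_softmax:
  "(softmax has_derivative (\<lambda>h. softmax_cov (softmax z) *v h)) (at z)"
proof (subst has_derivative_vec_nth_iff, rule allI)
  fix i
  let ?S = "\<Sum>j\<in>UNIV. exp (z $ j)"
  have S: "?S > 0" by (intro sum_pos) auto
  have "((\<lambda>z. exp (z $ i) / (\<Sum>j\<in>UNIV. exp (z $ j))) has_derivative
      (\<lambda>h. (exp (z $ i) * h $ i * ?S - exp (z $ i) * (\<Sum>j\<in>UNIV. exp (z $ j) * h $ j)) / (?S * ?S)))
      (at z)"
    using S by (auto intro!: derivative_eq_intros bounded_linear_vec_nth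
        bounded_linear.has_derivative[OF bounded_linear_vec_nth] simp: mult.commute)
  \<comment> \<open>Each factor \<open>1 / ?S\<close> turns one exponential into a softmax entry,
    which gives the entry formula for \<open>softmax_cov\<close>.\<close>
  moreover have "(exp (z $ i) * h $ i * ?S - exp (z $ i) * (\<Sum>j\<in>UNIV. exp (z $ j) * h $ j)) / (?S * ?S)
      = (softmax_cov (softmax z) *v h) $ i" for h
    using S unfolding softmax_cov_mult_nth
    by (simp add: softmax_def field_simps flip: sum_divide_distrib)
  ultimately show "((\<lambda>z. softmax z $ i) has_derivative (\<lambda>h. (softmax_cov (softmax z) *v h) $ i)) (at z)"
    by (simp add: softmax_def)
qed

text \<open>Row \<open>i\<close> of the output depends only on row \<open>i\<close> of
  \<open>Z\<close>, so the chain rule through the projection to that row suffices.\<close>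

lemma has_derivative_softmax_rows:
  "(softmax_rows has_derivative
     (\<lambda>H. \<chi> i. softmax_cov (row i (softmax_rows Z)) *v row i H)) (at Z)"
proof (subst has_derivative_vec_nth_iff, rule allI)
  fix i
  have "((\<lambda>Z. softmax (Z $ i)) has_derivative (\<lambda>H. softmax_cov (softmax (Z $ i)) *v (H $ i))) (at Z)"
    by (rule has_derivative_compose[OF _ has_derivative_softmax])
      (rule bounded_linear_imp_has_derivative[OF bounded_linear_vec_nth])
  then show "((\<lambda>Z. softmax_rows Z $ i) has_derivative
      (\<lambda>H. (\<chi> i. softmax_cov (row i (softmax_rows Z)) *v row i H) $ i)) (at Z)"
    by (simp add: softmax_rows_def row_def)
qed

lemma has_derivative_attn:
  fixes X :: "real^'D^'N" and A :: "real^'D^'D"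
  defines "P \<equiv> softmax_rows (X ** A ** transpose X)"
  shows "(attn A WV has_derivative
    (\<lambda>H. P ** H ** WV +
      (\<chi> i. softmax_cov (row i P) *v row i (X ** A ** transpose H + H ** A ** transpose X)) ** X ** WV))
    (at X)"
proof -
  note mult = bounded_bilinear.FDERIV[OF bounded_bilinear_matrix_matrix_mult]
  note transp = bounded_linear.has_derivative[OF bounded_linear_transpose has_derivative_ident]
  have XA: "((\<lambda>X. X ** A) has_derivative (\<lambda>H. H ** A)) (at X)"
    by (intro bounded_linear_imp_has_derivative
        bounded_bilinear.bounded_linear_left[OF bounded_bilinear_matrix_matrix_mult])
  have score: "((\<lambda>X. X ** A ** transpose X) has_derivative
      (\<lambda>H. X ** A ** transpose H + H ** A ** transpose X)) (at X)"
    by (rule mult[OF XA transp])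
  have prob: "((\<lambda>X. softmax_rows (X ** A ** transpose X)) has_derivative
      (\<lambda>H. \<chi> i. softmax_cov (row i P) *v row i (X ** A ** transpose H + H ** A ** transpose X)))
      (at X)"
    unfolding P_def by (rule has_derivative_compose[OF score has_derivative_softmax_rows])
  have "((\<lambda>X. softmax_rows (X ** A ** transpose X) ** X ** WV) has_derivative
    (\<lambda>H. P ** H ** WV +
      (\<chi> i. softmax_cov (row i P) *v row i (X ** A ** transpose H + H ** A ** transpose X)) ** X ** WV))
    (at X)"
    \<comment> \<open>Multiplication by the constant \<open>WV\<close> is linear, so it is applied
      after the product rule for \<open>softmax_rows (X ** A ** transpose X) ** X\<close>.\<close>
    using bounded_linear.has_derivative[OF
        bounded_bilinear.bounded_linear_left[OF bounded_bilinear_matrix_matrix_mult]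
        mult[OF prob has_derivative_ident]]
    by (simp add: P_def bounded_bilinear.add_left[OF bounded_bilinear_matrix_matrix_mult])
  then show ?thesis by (simp add: attn_def[abs_def])
qed

theorem theorem3:
  fixes X :: "real^'D^'N"
    and WQ WK WV :: "real^'d^'D"
    and A :: "real^'D^'D"
    and P :: "real^'N^'N"
  assumes "A = (1 / sqrt (real CARD('d))) *\<^sub>R (WQ ** transpose WK)"
    and "P = softmax_rows (X ** A ** transpose X)"
  shows "spectral_norm (matrix_jacobian (attn A WV) X) \<le>
    spectral_norm WV *
      (spectral_norm P +
        2 * (spectral_norm X)\<^sup>2 * spectral_norm A *
          (MAX i\<in>UNIV. spectral_norm (softmax_cov (row i P))))"
proof (rule spectral_norm_le)
  fix v
  define H :: "real^'D^'N" where "H = unvec_row_major v"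
  define m where "m = (MAX i\<in>UNIV. spectral_norm (softmax_cov (row i P)))"
  define dZ where "dZ = X ** A ** transpose H + H ** A ** transpose X"
  define dP where "dP = (\<chi> i. softmax_cov (row i P) *v row i dZ)"
  note nonneg = spectral_norm_nonneg
  have v: "v = vec_row_major H" by (simp add: H_def)
  have m_ge: "spectral_norm (softmax_cov (row i P)) \<le> m" for i
    unfolding m_def by (intro Max_ge) auto
  then have m: "0 \<le> m" using nonneg order_trans by blast
  \<comment> \<open>The perturbation \<open>H\<close> is always measured in the Frobenius norm and
    the other factors in the spectral norm: here they are peeled off from the right, in
    \<open>XAH\<close> from the left.\<close>
  have HAX: "norm (H ** A ** transpose X) \<le> norm H * spectral_norm A * spectral_norm X"
    using norm_matrix_mult_le_right[of "H ** A" "transpose X"]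
      mult_right_mono[OF norm_matrix_mult_le_right[of H A] nonneg[of X]]
    by (simp add: spectral_norm_transpose)
  have XAH: "norm (X ** A ** transpose H) \<le> spectral_norm X * (spectral_norm A * norm H)"
    using norm_matrix_mult_le_left[of X "A ** transpose H"]
      mult_left_mono[OF norm_matrix_mult_le_left[of A "transpose H"] nonneg[of X]]
    by (simp add: norm_transpose matrix_mul_assoc)
  \<comment> \<open>The factor 2 comes from the two occurrences of \<open>X\<close> in the score
    matrix.\<close>
  have dZ: "norm dZ \<le> 2 * spectral_norm X * spectral_norm A * norm H"
    using norm_triangle_ineq[of "X ** A ** transpose H" "H ** A ** transpose X"] HAX XAH
    by (simp add: dZ_def mult_ac)
  \<comment> \<open>The covariance matrix varies with the row, so the uniform constant is the
    maximum \<open>m\<close>.\<close>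
  have "norm dP \<le> m * norm dZ"
  proof (rule norm_le_rows[OF _ m])
    fix i
    have "norm (dP $ i) \<le> spectral_norm (softmax_cov (row i P)) * norm (dZ $ i)"
      using norm_matrix_vector_mult_le[of "softmax_cov (row i P)" "row i dZ"]
      by (simp add: dP_def row_def)
    then show "norm (dP $ i) \<le> m * norm (dZ $ i)"
      using mult_right_mono[OF m_ge[of i] norm_ge_zero[of "dZ $ i"]] by linarith
  qed
  also have "\<dots> \<le> m * (2 * spectral_norm X * spectral_norm A * norm H)"
    using dZ m by (rule mult_left_mono)
  finally have dP: "norm dP \<le> m * (2 * spectral_norm X * spectral_norm A * norm H)" .
  \<comment> \<open>This second factor \<open>spectral_norm X\<close> produces the square in the
    bound.\<close>
  have "norm (dP ** X) \<le> m * (2 * spectral_norm X * spectral_norm A * norm H) * spectral_norm X"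
    using norm_matrix_mult_le_right[of dP X] mult_right_mono[OF dP nonneg[of X]] by linarith
  then have "norm (P ** H + dP ** X) \<le>
      (spectral_norm P + 2 * (spectral_norm X)\<^sup>2 * spectral_norm A * m) * norm H"
    using norm_triangle_ineq[of "P ** H" "dP ** X"] norm_matrix_mult_le_left[of P H]
    by (simp add: power2_eq_square algebra_simps)
  then have "norm ((P ** H + dP ** X) ** WV) \<le>
      (spectral_norm P + 2 * (spectral_norm X)\<^sup>2 * spectral_norm A * m) * norm H * spectral_norm WV"
    using norm_matrix_mult_le_right[of "P ** H + dP ** X" WV] mult_right_mono nonneg order_trans
    by blast
  \<comment> \<open>Both terms of the derivative end in \<open>WV\<close>; factoring it out lets the
    estimate above be used with a single factor \<open>spectral_norm WV\<close>.\<close>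
  moreover have "matrix_jacobian (attn A WV) X *v v = vec_row_major ((P ** H + dP ** X) ** WV)"
    using matrix_jacobian_works[OF has_derivative_attn[of A WV X], of H]
    by (simp add: v dP_def dZ_def assms(2) bounded_bilinear.add_left[OF bounded_bilinear_matrix_matrix_mult])
  ultimately show "norm (matrix_jacobian (attn A WV) X *v v) \<le> spectral_norm WV *
      (spectral_norm P + 2 * (spectral_norm X)\<^sup>2 * spectral_norm A *
        (MAX i\<in>UNIV. spectral_norm (softmax_cov (row i P)))) * norm v"
    by (simp add: v norm_vec_row_major mult_ac flip: m_def)
qed

end
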